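(* Let $n=|Ag|\geq 1$ and $\mathsf{X}\subseteq\{\mathbf{D2},\mathbf{D3},\mathbf{D4},\mathbf{D5}\}$. If a sequent $\Lambda$ is valid relative to $\mathsf{DS}_{n}\mathsf{X}$, then $\Lambda$ is derivable in $\mathsf{G3DS}_{n}\mathsf{X}$.
   Context: Language $\mathcal{L}_n$: $Ag=\{1,\dots,n\}$, $Atm$ countable set of atoms; formulas (negation normal form) $\phi::=p\mid\neg p\mid\phi\lor\phi\mid\phi\land\phi\mid\Box\phi\mid\Diamond\phi\mid[i]\phi\mid\langle i\rangle\phi\mid\otimes_i\phi\mid\ominus_i\phi$. A $\mathsf{DS}_n$-frame is $\langle W,R_\Box,\{R_{[i]}\}_{i\in Ag},\{R_{\otimes_i}\}_{i\in Ag}\rangle$, $W\neq\emptyset$, with: (C1) $R_\Box$ an equivalence relation; (C2) each $R_{[i]}\subseteq R_\Box$ an equivalence relation; (C3) for all $w$ and $u_1,\dots,u_n\in R_\Box(w)$, $\bigcap_i R_{[i]}(u_i)\neq\emptyset$; (D1) $R_\Box wv$ and $R_{\otimes_i}wu$ imply $R_{\otimes_i}vu$. Optional: (D2) each $w$ has an $R_{\otimes_i}$-successor; (D3) $R_{\otimes_i}\subseteq R_\Box$; (D4) $R_{\otimes_i}wv$, $R_{[i]}vu$ imply $R_{\otimes_i}wu$; (D5) each $w$ has $v$ with $R_{\otimes_i}wv$ and $R_{[i]}(v)\subseteq R_{\otimes_i}(w)$. $\mathsf{DS}_n\mathsf{X}$-frames additionally satisfy the properties in $\mathsf{X}$ (for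 all $i$); models add $V:Atm\to\mathcal{P}(W)$; $\Box,[i],\otimes_i$ are interpreted universally and $\Diamond,\langle i\rangle,\ominus_i$ existentially over $R_\Box,R_{[i]},R_{\otimes_i}$; literals, $\land,\lor$ classically. Sequents $\mathcal{R}\vdash\Gamma$: $\mathcal{R}$ a multiset of relational atoms $R_\Box xy,R_{[i]}xy,R_{\otimes_i}xy$, $\Gamma$ a multiset of labelled formulas $x:\phi$. For model $M$ and $I$ from labels to worlds, $M,I\models\mathcal{R}\vdash\Gamma$ iff, whenever all atoms of $\mathcal{R}$ hold under $I$, some $z:\phi\in\Gamma$ has $M,I(z)\Vdash\phi$; valid relative to $\mathsf{DS}_n\mathsf{X}$ means this holds for all $\mathsf{DS}_n\mathsf{X}$-models and all $I$. Paths: $x\sim^{\mathcal{R}}_i y$ iff $x=y$ or $x,y$ are connected by a chain of $R_{[i]}$-atoms of $\mathcal{R}$ taken in either direction; $x\sim^{\mathcal{R}}_\Diamond y$ likewise with $R_\Box$- or any $R_{[j]}$-atoms. Calculus $\mathsf{G3DS}_n$ (premise(s) $\Rightarrow$ conclusion; fresh = not in conclusion): (id) $\mathcal{R}\vdash x:p,x:\neg p,\Gamma$; ($\lor$) $x:\phi,x:\psi\Rightarrow x:\phi\lor\psi$; ($\land$) two premises $x:\phi$, $x:\psi\Rightarrow x:\phi\land\psi$; ($\Box$) $\mathcal{R},R_\Box xy\vdash y:\phi,\Gamma\Rightarrow\mathcal{R}\vdash x:\Box\phi,\Gamma$, $y$ fresh; ($\Diamond$) $\mathcal{R}\vdash x:\Diamond\phi,y:\phi,\Gamma\Rightarrow\mathcal{R}\vdash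 x:\Diamond\phi,\Gamma$ if $x\sim^{\mathcal{R}}_\Diamond y$; ($[i]$) analogous to ($\Box$) with $R_{[i]}$; ($\langle i\rangle$) analogous to ($\Diamond$) with condition $x\sim^{\mathcal{R}}_i y$; ($\otimes_i$) analogous to ($\Box$) with $R_{\otimes_i}$; ($\ominus_i$) $\mathcal{R},R_{\otimes_i}xy\vdash x:\ominus_i\phi,y:\phi,\Gamma\Rightarrow\mathcal{R},R_{\otimes_i}xy\vdash x:\ominus_i\phi,\Gamma$; (IOA) $\mathcal{R},R_{[1]}x_1y,\dots,R_{[n]}x_ny\vdash\Gamma\Rightarrow\mathcal{R}\vdash\Gamma$, $y$ fresh, $x_j\sim^{\mathcal{R}}_\Diamond x_{j+1}$ for all $j$; (D1$_i$) $\mathcal{R},R_{\otimes_i}xz,R_{\otimes_i}yz\vdash\Gamma\Rightarrow\mathcal{R},R_{\otimes_i}xz\vdash\Gamma$ if $x\sim^{\mathcal{R}}_\Diamond y$. Extra rules: (D2$_i$) $\mathcal{R},R_{\otimes_i}xy\vdash\Gamma\Rightarrow\mathcal{R}\vdash\Gamma$, $y$ fresh; (D3$_i$) $\mathcal{R},R_{\otimes_i}xy,R_\Box xy\vdash\Gamma\Rightarrow\mathcal{R},R_{\otimes_i}xy\vdash\Gamma$; (D4$_i$) $\mathcal{R},R_{\otimes_i}xy,R_{\otimes_i}xz\vdash\Gamma\Rightarrow\mathcal{R},R_{\otimes_i}xy\vdash\Gamma$ if $y\sim^{\mathcal{R}}_i z$; (D5$_i$) the system of (D5$^1_i$) $\mathcal{R},R_{\otimes_i}xy\vdash\Gamma\Rightarrow\mathcal{R}\vdash\Gamma$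 ($y$ fresh) and (D5$^2_i$) $\mathcal{R}',R_{\otimes_i}xz\vdash\Gamma'\Rightarrow\mathcal{R}'\vdash\Gamma'$ where $y\sim^{\mathcal{R}'}_i z$ and $R_{\otimes_i}xy$ was introduced by an application of (D5$^1_i$) further down in the derivation. $\mathsf{G3DS}_n\mathsf{X}$ is $\mathsf{G3DS}_n$ plus (D$K_i$) for all $i$ whenever $\mathbf{D}K\in\mathsf{X}$. Derivations are finite trees with (id) leaves. *)

theory Defs
  imports "HOL-Library.Multiset" "HOL-Library.Countable"
begin

type_synonym agent = nat
type_synonym label = nat

definition Ag :: "nat \<Rightarrow> agent set" where
  "Ag n = {1..n}"

text \<open>
  Formulas in negation normal form. \<open>Stit\<close>, \<open>CoStit\<close> stand for \<open>[i]\<close>, \<open>\<langle>i\<rangle>\<close>;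
  \<open>Ought\<close>, \<open>CoOught\<close> stand for \<open>\<otimes>\<^sub>i\<close>, \<open>\<ominus>\<^sub>i\<close>.
  The language for \<open>n\<close> agents is carved out by \<open>form_agents \<phi> \<subseteq> Ag n\<close>.
\<close>

datatype 'p form =
    Pos 'p
  | Neg 'p
  | Or "'p form" "'p form"
  | And "'p form" "'p form"
  | Box "'p form"
  | Dia "'p form"
  | Stit agent "'p form"
  | CoStit agent "'p form"
  | Ought agent "'p form"
  | CoOught agent "'p form"

primrec form_agents :: "'p form \<Rightarrow> agent set" where
  "form_agents (Pos p) = {}"
| "form_agents (Neg p) = {}"
| "form_agents (Or \<phi> \<psi>) = form_agents \<phi> \<union> form_agents \<psi>"
| "form_agents (And \<phi> \<psi>) = form_agents \<phi> \<union> form_agents \<psi>"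
| "form_agents (Box \<phi>) = form_agents \<phi>"
| "form_agents (Dia \<phi>) = form_agents \<phi>"
| "form_agents (Stit i \<phi>) = insert i (form_agents \<phi>)"
| "form_agents (CoStit i \<phi>) = insert i (form_agents \<phi>)"
| "form_agents (Ought i \<phi>) = insert i (form_agents \<phi>)"
| "form_agents (CoOught i \<phi>) = insert i (form_agents \<phi>)"


section \<open>Frames and models\<close>

datatype dprop = D2 | D3 | D4 | D5

text \<open>The values of \<open>Rstit\<close> and \<open>Rought\<close> at indices outside \<open>Ag n\<close> are irrelevant.\<close>

record 'w frame =
  Worlds :: "'w set"
  Rbox :: "('w \<times> 'w) set"
  Rstit :: "agent \<Rightarrow> ('w \<times> 'w) set"
  Rought :: "agent \<Rightarrow> ('w \<times> 'w) set"

record ('w, 'p) model = "'w frame" +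
  Val :: "'p \<Rightarrow> 'w set"

definition DS_frame :: "nat \<Rightarrow> ('w, 'm) frame_scheme \<Rightarrow> bool" where
  "DS_frame n F \<longleftrightarrow>
     Worlds F \<noteq> {} \<and>
     (\<forall>i\<in>Ag n. Rought F i \<subseteq> Worlds F \<times> Worlds F) \<and>
     equiv (Worlds F) (Rbox F) \<and>
     (\<forall>i\<in>Ag n. Rstit F i \<subseteq> Rbox F \<and> equiv (Worlds F) (Rstit F i)) \<and>
     (\<forall>w\<in>Worlds F. \<forall>u. (\<forall>i\<in>Ag n. u i \<in> Rbox F `` {w}) \<longrightarrow>
        (\<Inter>i\<in>Ag n. Rstit F i `` {u i}) \<noteq> {}) \<and>
     (\<forall>i\<in>Ag n. \<forall>w v u. (w, v) \<in> Rbox F \<and> (w, u) \<in> Rought F i \<longrightarrow> (v, u) \<in> Rought F i)"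

primrec frame_prop :: "dprop \<Rightarrow> ('w, 'm) frame_scheme \<Rightarrow> agent \<Rightarrow> bool" where
  "frame_prop D2 F i \<longleftrightarrow> (\<forall>w\<in>Worlds F. \<exists>v. (w, v) \<in> Rought F i)"
| "frame_prop D3 F i \<longleftrightarrow> Rought F i \<subseteq> Rbox F"
| "frame_prop D4 F i \<longleftrightarrow>
     (\<forall>w v u. (w, v) \<in> Rought F i \<and> (v, u) \<in> Rstit F i \<longrightarrow> (w, u) \<in> Rought F i)"
| "frame_prop D5 F i \<longleftrightarrow>
     (\<forall>w\<in>Worlds F. \<exists>v. (w, v) \<in> Rought F i \<and> Rstit F i `` {v} \<subseteq> Rought F i `` {w})"

definition DSX_frame :: "nat \<Rightarrow> dprop set \<Rightarrow> ('w, 'm) frame_scheme \<Rightarrow> bool" where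
  "DSX_frame n X F \<longleftrightarrow> DS_frame n F \<and> (\<forall>d\<in>X. \<forall>i\<in>Ag n. frame_prop d F i)"

definition DSX_model :: "nat \<Rightarrow> dprop set \<Rightarrow> ('w, 'p) model \<Rightarrow> bool" where
  "DSX_model n X M \<longleftrightarrow> DSX_frame n X M \<and> (\<forall>p. Val M p \<subseteq> Worlds M)"

primrec sat :: "('w, 'p) model \<Rightarrow> 'w \<Rightarrow> 'p form \<Rightarrow> bool" where
  "sat M w (Pos p) \<longleftrightarrow> w \<in> Val M p"
| "sat M w (Neg p) \<longleftrightarrow> w \<notin> Val M p"
| "sat M w (Or \<phi> \<psi>) \<longleftrightarrow> sat M w \<phi> \<or> sat M w \<psi>"
| "sat M w (And \<phi> \<psi>) \<longleftrightarrow> sat M w \<phi> \<and> sat M w \<psi>"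
| "sat M w (Box \<phi>) \<longleftrightarrow> (\<forall>v. (w, v) \<in> Rbox M \<longrightarrow> sat M v \<phi>)"
| "sat M w (Dia \<phi>) \<longleftrightarrow> (\<exists>v. (w, v) \<in> Rbox M \<and> sat M v \<phi>)"
| "sat M w (Stit i \<phi>) \<longleftrightarrow> (\<forall>v. (w, v) \<in> Rstit M i \<longrightarrow> sat M v \<phi>)"
| "sat M w (CoStit i \<phi>) \<longleftrightarrow> (\<exists>v. (w, v) \<in> Rstit M i \<and> sat M v \<phi>)"
| "sat M w (Ought i \<phi>) \<longleftrightarrow> (\<forall>v. (w, v) \<in> Rought M i \<longrightarrow> sat M v \<phi>)"
| "sat M w (CoOught i \<phi>) \<longleftrightarrow> (\<exists>v. (w, v) \<in> Rought M i \<and> sat M v \<phi>)"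


section \<open>Labelled sequents\<close>

datatype ratom =
    RBox label label
  | RStit agent label label
  | ROught agent label label

type_synonym 'p sequent = "ratom multiset \<times> (label \<times> 'p form) multiset"

primrec ratom_labels :: "ratom \<Rightarrow> label set" where
  "ratom_labels (RBox x y) = {x, y}"
| "ratom_labels (RStit i x y) = {x, y}"
| "ratom_labels (ROught i x y) = {x, y}"

primrec ratom_agents :: "ratom \<Rightarrow> agent set" where
  "ratom_agents (RBox x y) = {}"
| "ratom_agents (RStit i x y) = {i}"
| "ratom_agents (ROught i x y) = {i}"

definition labels :: "'p sequent \<Rightarrow> label set" where
  "labels S = (\<Union>a\<in>set_mset (fst S). ratom_labels a) \<union> fst ` set_mset (snd S)"

definition sequent_over :: "nat \<Rightarrow> 'p sequent \<Rightarrow> bool" where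
  "sequent_over n S \<longleftrightarrow>
     (\<forall>a\<in>#fst S. ratom_agents a \<subseteq> Ag n) \<and> (\<forall>(x, \<phi>)\<in>#snd S. form_agents \<phi> \<subseteq> Ag n)"

primrec ratom_holds :: "('w, 'p) model \<Rightarrow> (label \<Rightarrow> 'w) \<Rightarrow> ratom \<Rightarrow> bool" where
  "ratom_holds M I (RBox x y) \<longleftrightarrow> (I x, I y) \<in> Rbox M"
| "ratom_holds M I (RStit i x y) \<longleftrightarrow> (I x, I y) \<in> Rstit M i"
| "ratom_holds M I (ROught i x y) \<longleftrightarrow> (I x, I y) \<in> Rought M i"

definition sat_sequent :: "('w, 'p) model \<Rightarrow> (label \<Rightarrow> 'w) \<Rightarrow> 'p sequent \<Rightarrow> bool" where
  "sat_sequent M I S \<longleftrightarrow>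
     ((\<forall>a\<in>#fst S. ratom_holds M I a) \<longrightarrow> (\<exists>(z, \<phi>)\<in>#snd S. sat M (I z) \<phi>))"

text \<open>
  HOL cannot quantify over the type of worlds inside a formula, so validity carries that type as a
  parameter: the models are those whose set of worlds is an arbitrary nonempty subset of \<open>'w\<close>.
\<close>

definition valid :: "'w itself \<Rightarrow> nat \<Rightarrow> dprop set \<Rightarrow> 'p sequent \<Rightarrow> bool" where
  "valid (_ :: 'w itself) n X S \<longleftrightarrow>
     (\<forall>(M :: ('w, 'p) model) I.
        DSX_model n X M \<and> (\<forall>x. I x \<in> Worlds M) \<longrightarrow> sat_sequent M I S)"


section \<open>The calculus\<close>

definition path_stit :: "agent \<Rightarrow> ratom multiset \<Rightarrow> label \<Rightarrow> label \<Rightarrow> bool" where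
  "path_stit i R = equivclp (\<lambda>x y. RStit i x y \<in># R)"

definition path_dia :: "ratom multiset \<Rightarrow> label \<Rightarrow> label \<Rightarrow> bool" where
  "path_dia R = equivclp (\<lambda>x y. RBox x y \<in># R \<or> (\<exists>j. RStit j x y \<in># R))"

text \<open>
  \<open>G3DS n X T S\<close>: the sequent \<open>S\<close> is the root of a derivation placed above applications of the first
  \<open>D5\<close> rule that introduced exactly the atoms \<open>ROught i x y\<close> with \<open>(i, x, y) \<in> T\<close>. The second \<open>D5\<close>
  rule may refer to these atoms only. No rule deletes relational atoms from conclusion to premise,
  so \<open>y\<close> cannot become fresh again further up, and a triple in \<open>T\<close> always denotes the atom that
  was introduced.

  An eigenvariable must also differ from the other labels of the atoms introduced together with it;
  in \<open>IOA\<close>, \<open>D2\<close>, \<open>D5_1\<close> these labels need not occur in the conclusion, hence the explicit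
  inequalities.
\<close>

inductive G3DS ::
  "nat \<Rightarrow> dprop set \<Rightarrow> (agent \<times> label \<times> label) set \<Rightarrow> 'p sequent \<Rightarrow> bool"
  for n :: nat and X :: "dprop set" where
  id:
    "G3DS n X T (R, {#(x, Pos p), (x, Neg p)#} + \<Gamma>)"
| disj:
    "G3DS n X T (R, {#(x, \<phi>), (x, \<psi>)#} + \<Gamma>)
     \<Longrightarrow> G3DS n X T (R, {#(x, Or \<phi> \<psi>)#} + \<Gamma>)"
| conj:
    "\<lbrakk>G3DS n X T (R, {#(x, \<phi>)#} + \<Gamma>); G3DS n X T (R, {#(x, \<psi>)#} + \<Gamma>)\<rbrakk>
     \<Longrightarrow> G3DS n X T (R, {#(x, And \<phi> \<psi>)#} + \<Gamma>)"
| box: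
    "\<lbrakk>G3DS n X T (R + {#RBox x y#}, {#(y, \<phi>)#} + \<Gamma>);
      y \<notin> labels (R, {#(x, Box \<phi>)#} + \<Gamma>)\<rbrakk>
     \<Longrightarrow> G3DS n X T (R, {#(x, Box \<phi>)#} + \<Gamma>)"
| dia:
    "\<lbrakk>G3DS n X T (R, {#(x, Dia \<phi>), (y, \<phi>)#} + \<Gamma>); path_dia R x y\<rbrakk>
     \<Longrightarrow> G3DS n X T (R, {#(x, Dia \<phi>)#} + \<Gamma>)"
| stit:
    "\<lbrakk>i \<in> Ag n; G3DS n X T (R + {#RStit i x y#}, {#(y, \<phi>)#} + \<Gamma>);
      y \<notin> labels (R, {#(x, Stit i \<phi>)#} + \<Gamma>)\<rbrakk>
     \<Longrightarrow> G3DS n X T (R, {#(x, Stit i \<phi>)#} + \<Gamma>)"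
| costit:
    "\<lbrakk>i \<in> Ag n; G3DS n X T (R, {#(x, CoStit i \<phi>), (y, \<phi>)#} + \<Gamma>); path_stit i R x y\<rbrakk>
     \<Longrightarrow> G3DS n X T (R, {#(x, CoStit i \<phi>)#} + \<Gamma>)"
| ought:
    "\<lbrakk>i \<in> Ag n; G3DS n X T (R + {#ROught i x y#}, {#(y, \<phi>)#} + \<Gamma>);
      y \<notin> labels (R, {#(x, Ought i \<phi>)#} + \<Gamma>)\<rbrakk>
     \<Longrightarrow> G3DS n X T (R, {#(x, Ought i \<phi>)#} + \<Gamma>)"
| coought:
    "\<lbrakk>i \<in> Ag n; G3DS n X T (R + {#ROught i x y#}, {#(x, CoOught i \<phi>), (y, \<phi>)#} + \<Gamma>)\<rbrakk>
     \<Longrightarrow> G3DS n X T (R + {#ROught i x y#}, {#(x, CoOught i \<phi>)#} + \<Gamma>)"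
| IOA:
    "\<lbrakk>G3DS n X T (R + image_mset (\<lambda>j. RStit j (x j) y) (mset_set (Ag n)), \<Gamma>);
      y \<notin> labels (R, \<Gamma>); \<forall>j\<in>Ag n. y \<noteq> x j;
      \<forall>j. j \<in> Ag n \<and> Suc j \<in> Ag n \<longrightarrow> path_dia R (x j) (x (Suc j))\<rbrakk>
     \<Longrightarrow> G3DS n X T (R, \<Gamma>)"
| D1:
    "\<lbrakk>i \<in> Ag n; G3DS n X T (R + {#ROught i x z, ROught i y z#}, \<Gamma>); path_dia R x y\<rbrakk>
     \<Longrightarrow> G3DS n X T (R + {#ROught i x z#}, \<Gamma>)"
| D2:
    "\<lbrakk>D2 \<in> X; i \<in> Ag n; G3DS n X T (R + {#ROught i x y#}, \<Gamma>);
      y \<notin> labels (R, \<Gamma>); y \<noteq> x\<rbrakk>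
     \<Longrightarrow> G3DS n X T (R, \<Gamma>)"
| D3:
    "\<lbrakk>D3 \<in> X; i \<in> Ag n; G3DS n X T (R + {#ROught i x y, RBox x y#}, \<Gamma>)\<rbrakk>
     \<Longrightarrow> G3DS n X T (R + {#ROught i x y#}, \<Gamma>)"
| D4:
    "\<lbrakk>D4 \<in> X; i \<in> Ag n; G3DS n X T (R + {#ROught i x y, ROught i x z#}, \<Gamma>); path_stit i R y z\<rbrakk>
     \<Longrightarrow> G3DS n X T (R + {#ROught i x y#}, \<Gamma>)"
| D5_1:
    "\<lbrakk>D5 \<in> X; i \<in> Ag n; G3DS n X (insert (i, x, y) T) (R + {#ROught i x y#}, \<Gamma>);
      y \<notin> labels (R, \<Gamma>); y \<noteq> x\<rbrakk>
     \<Longrightarrow> G3DS n X T (R, \<Gamma>)"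
| D5_2:
    "\<lbrakk>D5 \<in> X; i \<in> Ag n; (i, x, y) \<in> T; G3DS n X T (R + {#ROught i x z#}, \<Gamma>);
      path_stit i R y z\<rbrakk>
     \<Longrightarrow> G3DS n X T (R, \<Gamma>)"

definition derivable :: "nat \<Rightarrow> dprop set \<Rightarrow> 'p sequent \<Rightarrow> bool" where
  "derivable n X S \<longleftrightarrow> G3DS n X {} S"

end

theory Submission
  imports Defs
begin

text \<open>
  An underivable sequent is extended step by step, reading the rules bottom-up, along a chain of
  underivable sequents. Every instance of a rule is an element of a countable set of tasks, and
  the chain is chosen to be generic: for each task it reaches a stage where the task is either
  completed or will never become applicable. The union of the chain is a countermodel whose worlds
  are the labels. Since some rules erase their principal formula, every stage also remembers all
  the labelled formulas that have occurred so far.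
\<close>

section \<open>Stages of the bottom-up search\<close>

instance form :: (countable) countable
  by countable_datatype

text \<open>\<open>Used\<close> is the parameter \<open>T\<close> of \<open>G3DS\<close>: it keeps
  the atoms introduced by the first \<open>D5\<close> rule apart from all other ought atoms.\<close>

record 'p stage =
  Used :: "(agent \<times> label \<times> label) set"
  Atoms :: "ratom multiset"
  Forms :: "(label \<times> 'p form) multiset"
  Seen :: "(label \<times> 'p form) set"

text \<open>Says what the limit must contain for a formula whose rule erases it. For
  \<open>And\<close> one conjunct suffices, since a single underivable premise is followed. The
  value \<open>False\<close> marks the formulas that no rule erases.\<close>

primrec decomposed ::
  "ratom set \<Rightarrow> (label \<times> 'p form) set \<Rightarrow> label \<Rightarrow> 'p form \<Rightarrow> bool" where
  "decomposed A H x (Pos p) \<longleftrightarrow> False"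
| "decomposed A H x (Neg p) \<longleftrightarrow> False"
| "decomposed A H x (Or \<phi> \<psi>) \<longleftrightarrow> (x, \<phi>) \<in> H \<and> (x, \<psi>) \<in> H"
| "decomposed A H x (And \<phi> \<psi>) \<longleftrightarrow> (x, \<phi>) \<in> H \<or> (x, \<psi>) \<in> H"
| "decomposed A H x (Box \<phi>) \<longleftrightarrow> (\<exists>y. RBox x y \<in> A \<and> (y, \<phi>) \<in> H)"
| "decomposed A H x (Dia \<phi>) \<longleftrightarrow> False"
| "decomposed A H x (Stit i \<phi>) \<longleftrightarrow> (\<exists>y. RStit i x y \<in> A \<and> (y, \<phi>) \<in> H)"
| "decomposed A H x (CoStit i \<phi>) \<longleftrightarrow> False"
| "decomposed A H x (Ought i \<phi>) \<longleftrightarrow> (\<exists>y. ROught i x y \<in> A \<and> (y, \<phi>) \<in> H)"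
| "decomposed A H x (CoOught i \<phi>) \<longleftrightarrow> False"

lemma decomposed_mono:
  "decomposed A H x \<phi> \<Longrightarrow> A \<subseteq> A' \<Longrightarrow> H \<subseteq> H' \<Longrightarrow> decomposed A' H' x \<phi>"
  by (cases \<phi>) auto

text \<open>The last conjunct is the invariant behind \<open>Seen\<close>: a formula may be missing
  from the current sequent only if its rule has already had its effect.\<close>

definition good_stage :: "nat \<Rightarrow> dprop set \<Rightarrow> 'p stage \<Rightarrow> bool" where
  "good_stage n X s \<longleftrightarrow>
     \<not> G3DS n X (Used s) (Atoms s, Forms s) \<and> set_mset (Forms s) \<subseteq> Seen s \<and>
     (\<forall>(x, \<phi>)\<in>Seen s. (x, \<phi>) \<in># Forms s \<or>
        decomposed (set_mset (Atoms s)) (Seen s) x \<phi>)"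

text \<open>\<open>Forms\<close> is left out because it is not monotone along the search;
  \<open>Seen\<close> stands in for it.\<close>

definition extends :: "'p stage \<Rightarrow> 'p stage \<Rightarrow> bool" where
  "extends s s' \<longleftrightarrow>
     Used s \<subseteq> Used s' \<and> set_mset (Atoms s) \<subseteq> set_mset (Atoms s') \<and> Seen s \<subseteq> Seen s'"

lemma extends_refl: "extends s s"
  by (simp add: extends_def)

lemma extends_trans: "extends s s' \<Longrightarrow> extends s' s'' \<Longrightarrow> extends s s''"
  by (auto simp: extends_def)

text \<open>The general form of one backward rule application: \<open>C\<close> is replaced by
  \<open>B\<close>, and the atoms \<open>A\<close> are added. Only formulas of \<open>C\<close> can
  get lost, hence the condition on them; for formulas erased earlier the invariant survives by
  \<open>decomposed_mono\<close>.\<close>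

lemma good_stage_extend:
  assumes "good_stage n X s" and "Forms s = C + \<Gamma>" and "Used s \<subseteq> T'"
    and "\<not> G3DS n X T' (Atoms s + A, B + \<Gamma>)"
    and "\<forall>(x, \<phi>)\<in>#C. (x, \<phi>) \<in># B \<or>
           decomposed (set_mset (Atoms s + A)) (Seen s \<union> set_mset B) x \<phi>"
  defines "s' \<equiv> \<lparr>Used = T', Atoms = Atoms s + A, Forms = B + \<Gamma>, Seen = Seen s \<union> set_mset B\<rparr>"
  shows "good_stage n X s'" and "extends s s'"
proof -
  show "extends s s'"
    using assms(3) by (auto simp: extends_def s'_def)
  have "(x, \<phi>) \<in># B + \<Gamma> \<or> decomposed (set_mset (Atoms s + A)) (Seen s \<union> set_mset B) x \<phi>"
    if "(x, \<phi>) \<in> Seen s \<union> set_mset B" for x \<phi>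
  proof (cases "(x, \<phi>) \<in># B + \<Gamma>")
    case False
    then have seen: "(x, \<phi>) \<in> Seen s"
      using that by auto
    show ?thesis
    proof (cases "(x, \<phi>) \<in># C")
      case True
      then show ?thesis using assms(5) False by auto
    next
      case notC: False
      then have "decomposed (set_mset (Atoms s)) (Seen s) x \<phi>"
        using assms(1,2) seen False by (auto simp: good_stage_def)
      then have "decomposed (set_mset (Atoms s + A)) (Seen s \<union> set_mset B) x \<phi>"
        by (rule decomposed_mono) auto
      then show ?thesis by simp
    qed
  qed simp
  then show "good_stage n X s'"
    using assms(1,2,4) by (auto simp: good_stage_def s'_def)
qed

lemma ex_good_stage_extend:
  assumes "good_stage n X s" and "Forms s = C + \<Gamma>"
    and "\<not> G3DS n X T' (Atoms s + A, B + \<Gamma>)" and "Used s \<subseteq> T'"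
    and "\<forall>(x, \<phi>)\<in>#C. (x, \<phi>) \<in># B \<or>
           decomposed (set_mset (Atoms s + A)) (Seen s \<union> set_mset B) x \<phi>"
  shows "\<exists>s'. good_stage n X s' \<and> extends s s' \<and> Used s' = T' \<and> Atoms s' = Atoms s + A \<and>
           Seen s' = Seen s \<union> set_mset B"
  using good_stage_extend[OF assms(1,2,4,3,5)]
  by (intro exI[of _ "\<lparr>Used = T', Atoms = Atoms s + A, Forms = B + \<Gamma>,
        Seen = Seen s \<union> set_mset B\<rparr>"]) simp

lemma ex_good_stage_add_atoms:
  assumes "good_stage n X s"
    and "\<not> G3DS n X T' (Atoms s + A, Forms s)" and "Used s \<subseteq> T'"
  shows "\<exists>s'. good_stage n X s' \<and> extends s s' \<and> Used s' = T' \<and> Atoms s' = Atoms s + A"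
  using ex_good_stage_extend[OF assms(1), of "{#}" "Forms s" T' A "{#}"] assms(2,3) by auto

lemma ex_good_stage_add_form:
  assumes "good_stage n X s"
    and "\<not> G3DS n X (Used s) (Atoms s, add_mset f (Forms s))"
  shows "\<exists>s'. good_stage n X s' \<and> extends s s' \<and> f \<in> Seen s'"
  using ex_good_stage_extend[OF assms(1), of "{#}" "Forms s" "Used s" "{#}" "{#f#}"] assms(2)
  by auto

text \<open>Provides the principal formula in the shape in which the rules state it. For
  diamond-like formulas the last assumption always holds, so these stay available forever.\<close>

lemma good_stage_persistent:
  assumes "good_stage n X s" and "(x, \<phi>) \<in> Seen s"
    and "\<not> decomposed (set_mset (Atoms s)) (Seen s) x \<phi>"
  obtains \<Gamma> where "Forms s = {#(x, \<phi>)#} + \<Gamma>"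
proof -
  have "(x, \<phi>) \<in># Forms s"
    using assms by (auto simp: good_stage_def)
  then show thesis
    using that by (metis add_mset_add_single mset_add union_commute)
qed

section \<open>Fresh labels, and paths in growing sets of atoms\<close>

lemma finite_labels: "finite (labels S)"
proof -
  have "finite (ratom_labels a)" for a
    by (cases a) auto
  then show ?thesis
    by (simp add: labels_def)
qed

text \<open>The set \<open>L\<close> is for labels that need not occur in the sequent but that an
  eigenvariable has to avoid, as in \<open>IOA\<close>, \<open>D2\<close> and
  \<open>D5_1\<close>.\<close>

lemma fresh_label:
  assumes "finite L"
  obtains y :: label where "y \<notin> labels S" and "y \<notin> L"
proof -
  have "finite (labels S \<union> L)"
    using assms finite_labels by blast
  then obtain y where "y \<notin> labels S \<union> L"
    using ex_new_if_finite infinite_UNIV_nat by blast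
  then show thesis using that by auto
qed

text \<open>Rules such as \<open>D1\<close> and \<open>D4\<close> state their path condition without
  the principal ought atom, whereas tasks state it for all atoms of a stage. Paths ignore ought
  atoms, so the two agree.\<close>

lemma path_dia_add_ROught [simp]: "path_dia (add_mset (ROught i x z) R) = path_dia R"
  by (simp add: path_dia_def)

lemma path_stit_add_ROught [simp]: "path_stit j (add_mset (ROught i x z) R) = path_stit j R"
  by (simp add: path_stit_def)

lemma equivclp_mono:
  assumes "equivclp r x y" and "\<And>x y. r x y \<Longrightarrow> s x y"
  shows "equivclp s x y"
  using assms(1)
proof (induction rule: equivclp_induct)
  case base
  then show ?case by simp
next
  case (step y z)
  then show ?case
    using assms(2) by (meson equivclp_into_equivclp)
qed

lemma path_dia_mono:
  "path_dia R x y \<Longrightarrow> set_mset R \<subseteq> set_mset R' \<Longrightarrow> path_dia R' x y"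
  unfolding path_dia_def by (erule equivclp_mono) auto

lemma path_stit_mono:
  "path_stit i R x y \<Longrightarrow> set_mset R \<subseteq> set_mset R' \<Longrightarrow> path_stit i R' x y"
  unfolding path_stit_def by (erule equivclp_mono) auto

text \<open>A path has finitely many steps, each present from some index on; the maximum of these
  indices serves for the whole path.\<close>

lemma equivclp_chain_union:
  fixes r :: "nat \<Rightarrow> 'a \<Rightarrow> 'a \<Rightarrow> bool"
  assumes "equivclp (\<lambda>x y. \<exists>k. r k x y) x y"
    and mono: "\<And>j k x y. j \<le> k \<Longrightarrow> r j x y \<Longrightarrow> r k x y"
  shows "\<exists>k. equivclp (r k) x y"
  using assms(1)
proof (induction rule: equivclp_induct)
  case base
  then show ?case by simp
next
  case (step y z)
  then obtain j k where j: "r j y z \<or> r j z y" and k: "equivclp (r k) x y"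
    by blast
  have "equivclp (r (max j k)) x y"
    using k by (rule equivclp_mono) (simp add: mono[of k "max j k"])
  moreover have "r (max j k) y z \<or> r (max j k) z y"
    using j mono[of j "max j k"] by auto
  ultimately show ?case
    by (meson equivclp_into_equivclp)
qed

section \<open>Tasks and their completion\<close>

text \<open>A task is a rule instance without its eigenvariable, which is chosen only when the task
  is carried out. \<open>TIOA\<close> takes a list instead of a function on agents so that the type
  stays countable; entry \<open>j\<close> is the label for agent \<open>j\<close>.\<close>

datatype 'p task =
    TDecompose label "'p form"
  | TDia label "'p form" label
  | TCoStit agent label "'p form" label
  | TCoOught agent label "'p form" label
  | TIOA "label list"
  | TD1 agent label label label
  | TD2 agent label
  | TD3 agent label label
  | TD4 agent label label label
  | TD5_1 agent label
  | TD5_2 agent label label label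

instance task :: (countable) countable
  by countable_datatype

text \<open>The formulas whose rule erases them, restricted to the agents for which there is such a
  rule.\<close>

fun decomposable :: "nat \<Rightarrow> 'p form \<Rightarrow> bool" where
  "decomposable n (Or \<phi> \<psi>) \<longleftrightarrow> True"
| "decomposable n (And \<phi> \<psi>) \<longleftrightarrow> True"
| "decomposable n (Box \<phi>) \<longleftrightarrow> True"
| "decomposable n (Stit i \<phi>) \<longleftrightarrow> i \<in> Ag n"
| "decomposable n (Ought i \<phi>) \<longleftrightarrow> i \<in> Ag n"
| "decomposable n _ \<longleftrightarrow> False"

text \<open>Principal formulas are looked up in \<open>Seen\<close> rather than in
  \<open>Forms\<close>; this makes applicability monotone.\<close>

primrec applicable :: "nat \<Rightarrow> dprop set \<Rightarrow> 'p stage \<Rightarrow> 'p task \<Rightarrow> bool" where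
  "applicable n X s (TDecompose x \<phi>) \<longleftrightarrow> decomposable n \<phi> \<and> (x, \<phi>) \<in> Seen s"
| "applicable n X s (TDia x \<phi> y) \<longleftrightarrow> (x, Dia \<phi>) \<in> Seen s \<and> path_dia (Atoms s) x y"
| "applicable n X s (TCoStit i x \<phi> y) \<longleftrightarrow>
     i \<in> Ag n \<and> (x, CoStit i \<phi>) \<in> Seen s \<and> path_stit i (Atoms s) x y"
| "applicable n X s (TCoOught i x \<phi> y) \<longleftrightarrow>
     i \<in> Ag n \<and> (x, CoOught i \<phi>) \<in> Seen s \<and> ROught i x y \<in># Atoms s"
| "applicable n X s (TIOA xs) \<longleftrightarrow>
     (\<forall>j. j \<in> Ag n \<and> Suc j \<in> Ag n \<longrightarrow> path_dia (Atoms s) (xs ! j) (xs ! Suc j))"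
| "applicable n X s (TD1 i x y z) \<longleftrightarrow>
     i \<in> Ag n \<and> ROught i x z \<in># Atoms s \<and> path_dia (Atoms s) x y"
| "applicable n X s (TD2 i x) \<longleftrightarrow> D2 \<in> X \<and> i \<in> Ag n"
| "applicable n X s (TD3 i x y) \<longleftrightarrow> D3 \<in> X \<and> i \<in> Ag n \<and> ROught i x y \<in># Atoms s"
| "applicable n X s (TD4 i x y z) \<longleftrightarrow>
     D4 \<in> X \<and> i \<in> Ag n \<and> ROught i x y \<in># Atoms s \<and> path_stit i (Atoms s) y z"
| "applicable n X s (TD5_1 i x) \<longleftrightarrow> D5 \<in> X \<and> i \<in> Ag n"
| "applicable n X s (TD5_2 i x y z) \<longleftrightarrow>
     D5 \<in> X \<and> i \<in> Ag n \<and> (i, x, y) \<in> Used s \<and> path_stit i (Atoms s) y z"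

primrec completed :: "nat \<Rightarrow> 'p stage \<Rightarrow> 'p task \<Rightarrow> bool" where
  "completed n s (TDecompose x \<phi>) \<longleftrightarrow> decomposed (set_mset (Atoms s)) (Seen s) x \<phi>"
| "completed n s (TDia x \<phi> y) \<longleftrightarrow> (y, \<phi>) \<in> Seen s"
| "completed n s (TCoStit i x \<phi> y) \<longleftrightarrow> (y, \<phi>) \<in> Seen s"
| "completed n s (TCoOught i x \<phi> y) \<longleftrightarrow> (y, \<phi>) \<in> Seen s"
| "completed n s (TIOA xs) \<longleftrightarrow> (\<exists>y. \<forall>j\<in>Ag n. RStit j (xs ! j) y \<in># Atoms s)"
| "completed n s (TD1 i x y z) \<longleftrightarrow> ROught i y z \<in># Atoms s"
| "completed n s (TD2 i x) \<longleftrightarrow> (\<exists>y. ROught i x y \<in># Atoms s)"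
| "completed n s (TD3 i x y) \<longleftrightarrow> RBox x y \<in># Atoms s"
| "completed n s (TD4 i x y z) \<longleftrightarrow> ROught i x z \<in># Atoms s"
| "completed n s (TD5_1 i x) \<longleftrightarrow> (\<exists>y. (i, x, y) \<in> Used s \<and> ROught i x y \<in># Atoms s)"
| "completed n s (TD5_2 i x y z) \<longleftrightarrow> ROught i x z \<in># Atoms s"

lemma applicable_mono: "applicable n X s t \<Longrightarrow> extends s s' \<Longrightarrow> applicable n X s' t"
  by (cases t) (auto simp: extends_def intro: path_dia_mono path_stit_mono)

text \<open>Each rule is used contrapositively: if the conclusion is underivable, so is some
  premise, and that premise becomes the next stage.\<close>

lemma complete_decompose:
  assumes good: "good_stage n X s" and mem: "(x, \<phi>) \<in> Seen s" and dec: "decomposable n \<phi>"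
  shows "\<exists>s'. good_stage n X s' \<and> extends s s' \<and> completed n s' (TDecompose x \<phi>)"
proof (cases "decomposed (set_mset (Atoms s)) (Seen s) x \<phi>")
  case True
  \<comment> \<open>The formula may already have been erased from \<open>Forms\<close>, but then
    there is nothing left to do.\<close>
  then show ?thesis
    using good extends_refl by auto
next
  case False
  obtain \<Gamma> where \<Gamma>: "Forms s = {#(x, \<phi>)#} + \<Gamma>"
    using good_stage_persistent[OF good mem False] .
  have nd: "\<not> G3DS n X (Used s) (Atoms s, {#(x, \<phi>)#} + \<Gamma>)"
    using good \<Gamma> by (simp add: good_stage_def)
  have step: ?thesis if "\<not> G3DS n X (Used s) (Atoms s + A, B + \<Gamma>)"
    and "decomposed (set_mset (Atoms s + A)) (Seen s \<union> set_mset B) x \<phi>" for A B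
    using ex_good_stage_extend[OF good \<Gamma> that(1)] that(2) by force
  \<comment> \<open>No further labels need avoiding: \<open>x\<close> itself occurs in the
    sequent.\<close>
  obtain y where y: "y \<notin> labels (Atoms s, {#(x, \<phi>)#} + \<Gamma>)"
    using fresh_label[of "{}"] by blast
  show ?thesis
  proof (cases \<phi>)
    case (Or \<alpha> \<beta>)
    then have "\<not> G3DS n X (Used s) (Atoms s, {#(x, \<alpha>), (x, \<beta>)#} + \<Gamma>)"
      using nd G3DS.disj by metis
    then show ?thesis
      using step[of "{#}" "{#(x, \<alpha>), (x, \<beta>)#}"] Or by auto
  next
    case (And \<alpha> \<beta>)
    then have "\<not> G3DS n X (Used s) (Atoms s, {#(x, \<alpha>)#} + \<Gamma>) \<or>
        \<not> G3DS n X (Used s) (Atoms s, {#(x, \<beta>)#} + \<Gamma>)"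
      using nd G3DS.conj by metis
    then show ?thesis
      using step[of "{#}" "{#(x, \<alpha>)#}"] step[of "{#}" "{#(x, \<beta>)#}"] And by auto
  next
    case (Box \<alpha>)
    then have "\<not> G3DS n X (Used s) (Atoms s + {#RBox x y#}, {#(y, \<alpha>)#} + \<Gamma>)"
      using nd y G3DS.box by metis
    then show ?thesis
      using step[of "{#RBox x y#}" "{#(y, \<alpha>)#}"] Box by auto
  next
    case (Stit i \<alpha>)
    then have "\<not> G3DS n X (Used s) (Atoms s + {#RStit i x y#}, {#(y, \<alpha>)#} + \<Gamma>)"
      using nd y dec G3DS.stit by (metis decomposable.simps(4))
    then show ?thesis
      using step[of "{#RStit i x y#}" "{#(y, \<alpha>)#}"] Stit by auto
  next
    case (Ought i \<alpha>)
    then have "\<not> G3DS n X (Used s) (Atoms s + {#ROught i x y#}, {#(y, \<alpha>)#} + \<Gamma>)"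
      using nd y dec G3DS.ought by (metis decomposable.simps(5))
    then show ?thesis
      using step[of "{#ROught i x y#}" "{#(y, \<alpha>)#}"] Ought by auto
  qed (use dec in auto)
qed

text \<open>Apart from decomposition, every rule keeps its principal formula and atoms, so its
  premise merely adds a formula or atoms to the current sequent.\<close>

lemma complete_task:
  assumes good: "good_stage n X s" and app: "applicable n X s t"
  shows "\<exists>s'. good_stage n X s' \<and> extends s s' \<and> completed n s' t"
proof -
  have nd: "\<not> G3DS n X (Used s) (Atoms s, Forms s)"
    using good by (simp add: good_stage_def)
  \<comment> \<open>Covers the rules that only add atoms; \<open>T'\<close> differs from
    \<open>Used s\<close> for \<open>D5_1\<close> alone.\<close>
  have rel: "\<exists>s'. good_stage n X s' \<and> extends s s' \<and> completed n s' t"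
    if "\<not> G3DS n X T' (Atoms s + A, Forms s)" and "Used s \<subseteq> T'"
      and "\<And>s'. Used s' = T' \<Longrightarrow> Atoms s' = Atoms s + A \<Longrightarrow> completed n s' t" for A T'
    using ex_good_stage_add_atoms[OF good that(1,2)] that(3) by blast
  show ?thesis
  proof (cases t)
    case (TDecompose x \<phi>)
    then show ?thesis
      using complete_decompose[OF good] app by simp
  next
    case (TDia x \<phi> y)
    then obtain \<Gamma> where \<Gamma>: "Forms s = {#(x, Dia \<phi>)#} + \<Gamma>"
      using app good_stage_persistent[OF good, of x "Dia \<phi>"] by auto
    then have "\<not> G3DS n X (Used s) (Atoms s, add_mset (y, \<phi>) (Forms s))"
      using nd app TDia G3DS.dia[of n X "Used s" "Atoms s" x \<phi> y \<Gamma>]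
      by (auto simp: add_mset_commute)
    then show ?thesis
      using ex_good_stage_add_form[OF good] TDia by auto
  next
    case (TCoStit i x \<phi> y)
    then obtain \<Gamma> where \<Gamma>: "Forms s = {#(x, CoStit i \<phi>)#} + \<Gamma>"
      using app good_stage_persistent[OF good, of x "CoStit i \<phi>"] by auto
    then have "\<not> G3DS n X (Used s) (Atoms s, add_mset (y, \<phi>) (Forms s))"
      using nd app TCoStit G3DS.costit[of i n X "Used s" "Atoms s" x \<phi> y \<Gamma>]
      by (auto simp: add_mset_commute)
    then show ?thesis
      using ex_good_stage_add_form[OF good] TCoStit by auto
  next
    case (TCoOught i x \<phi> y)
    then obtain \<Gamma> where \<Gamma>: "Forms s = {#(x, CoOught i \<phi>)#} + \<Gamma>"
      using app good_stage_persistent[OF good, of x "CoOught i \<phi>"] by auto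
    obtain R where "Atoms s = add_mset (ROught i x y) R"
      using app TCoOught by (auto dest: multi_member_split)
    then have "\<not> G3DS n X (Used s) (Atoms s, add_mset (y, \<phi>) (Forms s))"
      using nd app TCoOught \<Gamma> G3DS.coought[of i n X "Used s" R x y \<phi> \<Gamma>]
      by (auto simp: add_mset_commute)
    then show ?thesis
      using ex_good_stage_add_form[OF good] TCoOught by auto
  next
    case (TIOA xs)
    \<comment> \<open>The labels in \<open>xs\<close> may be absent from the sequent, so the
      eigenvariable has to avoid them separately.\<close>
    have "finite ((!) xs ` Ag n)"
      by (simp add: Ag_def)
    then obtain y where y: "y \<notin> labels (Atoms s, Forms s)" "y \<notin> (!) xs ` Ag n"
      by (rule fresh_label)
    have "\<not> G3DS n X (Used s)
        (Atoms s + image_mset (\<lambda>j. RStit j (xs ! j) y) (mset_set (Ag n)), Forms s)"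
      using nd y app TIOA G3DS.IOA[of n X "Used s" "Atoms s" "(!) xs" y "Forms s"] by auto
    then show ?thesis
      by (rule rel) (use TIOA in \<open>auto simp: Ag_def\<close>)
  next
    case (TD1 i x y z)
    then obtain R where "Atoms s = add_mset (ROught i x z) R"
      using app by (auto dest: multi_member_split)
    then have "\<not> G3DS n X (Used s) (Atoms s + {#ROught i y z#}, Forms s)"
      using nd app TD1 G3DS.D1[of i n X "Used s" R x z y "Forms s"]
      by (auto simp: add_mset_commute)
    then show ?thesis
      by (rule rel) (use TD1 in auto)
  next
    case (TD2 i x)
    obtain y where y: "y \<notin> labels (Atoms s, Forms s)" "y \<notin> {x}"
      using fresh_label[of "{x}"] by blast
    then have "\<not> G3DS n X (Used s) (Atoms s + {#ROught i x y#}, Forms s)"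
      using nd app TD2 G3DS.D2[of X i n "Used s" "Atoms s" x y "Forms s"] by auto
    then show ?thesis
      by (rule rel) (use TD2 in auto)
  next
    case (TD3 i x y)
    then obtain R where "Atoms s = add_mset (ROught i x y) R"
      using app by (auto dest: multi_member_split)
    then have "\<not> G3DS n X (Used s) (Atoms s + {#RBox x y#}, Forms s)"
      using nd app TD3 G3DS.D3[of X i n "Used s" R x y "Forms s"]
      by (auto simp: add_mset_commute)
    then show ?thesis
      by (rule rel) (use TD3 in auto)
  next
    case (TD4 i x y z)
    then obtain R where "Atoms s = add_mset (ROught i x y) R"
      using app by (auto dest: multi_member_split)
    then have "\<not> G3DS n X (Used s) (Atoms s + {#ROught i x z#}, Forms s)"
      using nd app TD4 G3DS.D4[of X i n "Used s" R x y z "Forms s"]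
      by (auto simp: add_mset_commute)
    then show ?thesis
      by (rule rel) (use TD4 in auto)
  next
    case (TD5_1 i x)
    obtain y where y: "y \<notin> labels (Atoms s, Forms s)" "y \<notin> {x}"
      using fresh_label[of "{x}"] by blast
    then have "\<not> G3DS n X (insert (i, x, y) (Used s)) (Atoms s + {#ROught i x y#}, Forms s)"
      using nd app TD5_1 G3DS.D5_1[of X i n x y "Used s" "Atoms s" "Forms s"] by auto
    then show ?thesis
      by (rule rel) (use TD5_1 in auto)
  next
    case (TD5_2 i x y z)
    then have "\<not> G3DS n X (Used s) (Atoms s + {#ROught i x z#}, Forms s)"
      using nd app G3DS.D5_2[of X i n x y "Used s" "Atoms s" z "Forms s"] by auto
    then show ?thesis
      by (rule rel) (use TD5_2 in auto)
  qed
qed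

text \<open>Literals are never erased, so two complementary ones would meet in the current sequent
  and make it an axiom.\<close>

lemma good_stage_consistent:
  assumes "good_stage n X s" and "(x, Pos p) \<in> Seen s"
  shows "(x, Neg p) \<notin> Seen s"
proof
  assume "(x, Neg p) \<in> Seen s"
  then have "(x, Neg p) \<in># Forms s" and "(x, Pos p) \<in># Forms s"
    using assms by (auto simp: good_stage_def)
  then obtain \<Delta> where \<Delta>: "Forms s = add_mset (x, Pos p) \<Delta>"
    by (auto dest: multi_member_split)
  moreover have "(x, Neg p) \<in># \<Delta>"
    using \<open>(x, Neg p) \<in># Forms s\<close> \<Delta> by simp
  ultimately obtain \<Gamma> where "Forms s = {#(x, Pos p), (x, Neg p)#} + \<Gamma>"
    by (auto dest: multi_member_split)
  then show False
    using assms(1) G3DS.id by (metis good_stage_def)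
qed

section \<open>The generic chain\<close>

text \<open>Step \<open>k\<close> settles the task with number \<open>k\<close>. Settling looks
  ahead to all good extensions, so a single visit to each task is enough, even if the task becomes
  applicable only later.\<close>

lemma generic_chain:
  fixes s :: "('p :: countable) stage"
  assumes "good_stage n X s"
  shows "\<exists>\<sigma> :: nat \<Rightarrow> 'p stage. \<sigma> 0 = s \<and> (\<forall>k. good_stage n X (\<sigma> k)) \<and>
    (\<forall>j k. j \<le> k \<longrightarrow> extends (\<sigma> j) (\<sigma> k)) \<and>
    (\<forall>t k. applicable n X (\<sigma> k) t \<longrightarrow> (\<exists>m. completed n (\<sigma> m) t))"
proof -
  \<comment> \<open>As in a forcing argument, the alternative to completion is that no good
    extension ever makes the task applicable.\<close>
  define settled where "settled s t \<longleftrightarrow> completed n s t \<or>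
    (\<forall>s'. good_stage n X s' \<longrightarrow> extends s s' \<longrightarrow> \<not> applicable n X s' t)"
    for s :: "'p stage" and t
  have "\<exists>\<sigma>. \<forall>k. (good_stage n X (\<sigma> k) \<and> (k = 0 \<longrightarrow> \<sigma> k = s)) \<and>
      (extends (\<sigma> k) (\<sigma> (Suc k)) \<and> settled (\<sigma> (Suc k)) (from_nat k))"
  proof (rule dependent_nat_choice)
    show "\<exists>s'. good_stage n X s' \<and> (0 = (0::nat) \<longrightarrow> s' = s)"
      using assms by auto
  next
    fix u :: "'p stage" and k :: nat
    assume u: "good_stage n X u \<and> (k = 0 \<longrightarrow> u = s)"
    have "\<exists>u'. good_stage n X u' \<and> extends u u' \<and> settled u' (from_nat k)"
    proof (cases "settled u (from_nat k)")
      case True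
      then show ?thesis using u extends_refl by blast
    next
      case False
      \<comment> \<open>If the task can still become applicable, the chain jumps to a stage where it
        is and completes it there.\<close>
      then obtain u' where "good_stage n X u'" "extends u u'" "applicable n X u' (from_nat k)"
        by (auto simp: settled_def)
      then show ?thesis
        using complete_task extends_trans unfolding settled_def by metis
    qed
    then show "\<exists>u'. (good_stage n X u' \<and> (Suc k = 0 \<longrightarrow> u' = s)) \<and>
        (extends u u' \<and> settled u' (from_nat k))"
      by auto
  qed
  then obtain \<sigma> where \<sigma>: "\<sigma> 0 = s" "\<And>k. good_stage n X (\<sigma> k)"
    "\<And>k. extends (\<sigma> k) (\<sigma> (Suc k))" "\<And>k. settled (\<sigma> (Suc k)) (from_nat k)"
    by blast
  have mono: "extends (\<sigma> j) (\<sigma> k)" if "j \<le> k" for j k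
    using that
  proof (induction k rule: dec_induct)
    case base
    then show ?case by (rule extends_refl)
  next
    case (step k)
    then show ?case using \<sigma>(3) extends_trans by blast
  qed
  have "\<exists>m. completed n (\<sigma> m) t" if "applicable n X (\<sigma> k) t" for t k
  proof -
    \<comment> \<open>The task with number \<open>to_nat t\<close> is settled in passing to the
      following stage.\<close>
    define m where "m = Suc (to_nat t)"
    have "applicable n X (\<sigma> (max k m)) t"
      using applicable_mono[OF that mono] by simp
    moreover have "settled (\<sigma> m) t"
      using \<sigma>(4)[of "to_nat t"] by (simp add: m_def)
    \<comment> \<open>Stage \<open>max k m\<close> is a good extension of stage \<open>m\<close> at
      which \<open>t\<close> is applicable, so \<open>t\<close> can only be settled by
      completion.\<close>
    moreover have "extends (\<sigma> m) (\<sigma> (max k m))"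
      by (simp add: mono)
    ultimately show ?thesis
      using \<sigma>(2) by (auto simp: settled_def)
  qed
  then show ?thesis
    using \<sigma>(1,2) mono by blast
qed

section \<open>Saturated sets and the countermodel\<close>

text \<open>
  The properties of the limit of a generic chain. All labels are worlds, including those that never
  occur in the chain, since the rules \<open>IOA\<close>, \<open>D2\<close> and \<open>D5_1\<close> apply to arbitrary labels.
\<close>

locale saturated =
  fixes n :: nat and X :: "dprop set" and A :: "ratom set" and H :: "(label \<times> 'p form) set"
    and PB :: "label \<Rightarrow> label \<Rightarrow> bool" and PS :: "agent \<Rightarrow> label \<Rightarrow> label \<Rightarrow> bool"
    and f :: "label \<Rightarrow> 'w"
  defines "PB \<equiv> equivclp (\<lambda>x y. RBox x y \<in> A \<or> (\<exists>j. RStit j x y \<in> A))"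
    and "PS \<equiv> \<lambda>i. equivclp (\<lambda>x y. RStit i x y \<in> A)"
  assumes inj: "inj f"
    and consistent: "(x, Pos p) \<in> H \<Longrightarrow> (x, Neg p) \<notin> H"
    and decompose: "(x, \<phi>) \<in> H \<Longrightarrow> decomposable n \<phi> \<Longrightarrow> decomposed A H x \<phi>"
    and dia: "(x, Dia \<phi>) \<in> H \<Longrightarrow> PB x y \<Longrightarrow> (y, \<phi>) \<in> H"
    and costit: "i \<in> Ag n \<Longrightarrow> (x, CoStit i \<phi>) \<in> H \<Longrightarrow> PS i x y \<Longrightarrow> (y, \<phi>) \<in> H"
    and coought: "i \<in> Ag n \<Longrightarrow> (x, CoOught i \<phi>) \<in> H \<Longrightarrow> ROught i x y \<in> A \<Longrightarrow> (y, \<phi>) \<in> H"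
    and ioa: "(\<And>j. j \<in> Ag n \<Longrightarrow> PB w (u j)) \<Longrightarrow> \<exists>y. \<forall>j\<in>Ag n. RStit j (u j) y \<in> A"
    and d1: "i \<in> Ag n \<Longrightarrow> ROught i x z \<in> A \<Longrightarrow> PB x y \<Longrightarrow> ROught i y z \<in> A"
    and d2: "D2 \<in> X \<Longrightarrow> i \<in> Ag n \<Longrightarrow> \<exists>y. ROught i x y \<in> A"
    and d3: "D3 \<in> X \<Longrightarrow> i \<in> Ag n \<Longrightarrow> ROught i x y \<in> A \<Longrightarrow> RBox x y \<in> A"
    and d4: "D4 \<in> X \<Longrightarrow> i \<in> Ag n \<Longrightarrow> ROught i x y \<in> A \<Longrightarrow> PS i y z \<Longrightarrow> ROught i x z \<in> A"
    and d5: "D5 \<in> X \<Longrightarrow> i \<in> Ag n \<Longrightarrow> \<exists>y. ROught i x y \<in> A \<and> (\<forall>z. PS i y z \<longrightarrow> ROught i x z \<in> A)"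
begin

text \<open>An atom is true exactly where its negation occurs in \<open>H\<close>. This refutes
  negative literals of \<open>H\<close> at once, and positive ones by consistency. The injection
  \<open>f\<close> places the labels in the given type of worlds.\<close>

definition countermodel :: "('w, 'p) model" where
  "countermodel =
     \<lparr>Worlds = range f,
      Rbox = {(f x, f y) | x y. PB x y},
      Rstit = (\<lambda>i. {(f x, f y) | x y. PS i x y}),
      Rought = (\<lambda>i. {(f x, f y) | x y. ROught i x y \<in> A}),
      Val = (\<lambda>p. {f x | x. (x, Neg p) \<in> H})\<rparr>"

lemma countermodel_simps [simp]:
  "Worlds countermodel = range f"
  "(f x, f y) \<in> Rbox countermodel \<longleftrightarrow> PB x y"
  "(f x, f y) \<in> Rstit countermodel i \<longleftrightarrow> PS i x y"
  "(f x, f y) \<in> Rought countermodel i \<longleftrightarrow> ROught i x y \<in> A"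
  "f x \<in> Val countermodel p \<longleftrightarrow> (x, Neg p) \<in> H"
  using inj by (auto simp: countermodel_def inj_eq)

lemma countermodel_relE:
  "(w, v) \<in> Rbox countermodel \<Longrightarrow> \<exists>x y. w = f x \<and> v = f y \<and> PB x y"
  "(w, v) \<in> Rstit countermodel i \<Longrightarrow> \<exists>x y. w = f x \<and> v = f y \<and> PS i x y"
  "(w, v) \<in> Rought countermodel i \<Longrightarrow> \<exists>x y. w = f x \<and> v = f y \<and> ROught i x y \<in> A"
  by (auto simp: countermodel_def)

lemma PB_equiv: "PB x x" "PB x y \<Longrightarrow> PB y x" "PB x y \<Longrightarrow> PB y z \<Longrightarrow> PB x z"
  unfolding PB_def by (auto intro: equivclp_sym equivclp_trans)

lemma PS_equiv: "PS i x x" "PS i x y \<Longrightarrow> PS i y x" "PS i x y \<Longrightarrow> PS i y z \<Longrightarrow> PS i x z"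
  unfolding PS_def by (auto intro: equivclp_sym equivclp_trans)

lemma PS_imp_PB: "PS i x y \<Longrightarrow> PB x y"
  unfolding PS_def PB_def by (erule equivclp_mono) auto

lemma equiv_image:
  assumes "\<And>x. P x x" "\<And>x y. P x y \<Longrightarrow> P y x" "\<And>x y z. P x y \<Longrightarrow> P y z \<Longrightarrow> P x z"
  shows "equiv (range f) {(f x, f y) | x y. P x y}"
proof (intro equivI refl_onI symI transI)
  fix u v w
  assume "(u, v) \<in> {(f x, f y) | x y. P x y}" "(v, w) \<in> {(f x, f y) | x y. P x y}"
  then obtain x y y' z where "u = f x" "v = f y" "P x y" "v = f y'" "w = f z" "P y' z"
    by blast
  moreover from this have "y = y'"
    using inj by (simp add: inj_eq)
  ultimately show "(u, w) \<in> {(f x, f y) | x y. P x y}"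
    using assms(3) by blast
qed (use assms(1,2) in blast)+

text \<open>Closing the atoms to equivalence relations yields (C1) and (C2); \<open>ioa\<close>,
  \<open>d1\<close> and \<open>d2\<close> to \<open>d5\<close> are the remaining frame conditions
  read on labels.\<close>

lemma DSX_model_countermodel: "DSX_model n X countermodel"
proof -
  have "DS_frame n countermodel"
    unfolding DS_frame_def
  proof (intro conjI ballI allI impI)
    show "Worlds countermodel \<noteq> {}"
      by simp
    show "equiv (Worlds countermodel) (Rbox countermodel)"
      using equiv_image[of PB, OF PB_equiv] by (simp add: countermodel_def)
    show "Rought countermodel i \<subseteq> Worlds countermodel \<times> Worlds countermodel" for i
      by (auto simp: countermodel_def)
    show "Rstit countermodel i \<subseteq> Rbox countermodel" for i
      using PS_imp_PB by (auto dest!: countermodel_relE)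
    show "equiv (Worlds countermodel) (Rstit countermodel i)" for i
      using equiv_image[of "PS i", OF PS_equiv] by (simp add: countermodel_def)
    show "(v, u) \<in> Rought countermodel i"
      if "i \<in> Ag n" "(w, v) \<in> Rbox countermodel \<and> (w, u) \<in> Rought countermodel i" for i w v u
      using that d1 inj by (fastforce dest!: countermodel_relE simp: inj_eq)
    show "(\<Inter>i\<in>Ag n. Rstit countermodel i `` {u i}) \<noteq> {}"
      if "w \<in> Worlds countermodel" "\<forall>i\<in>Ag n. u i \<in> Rbox countermodel `` {w}" for w u
    proof -
      obtain x where x: "w = f x"
        using \<open>w \<in> Worlds countermodel\<close> by auto
      \<comment> \<open>Worlds related to \<open>w\<close> lie in the range of \<open>f\<close>, so
        \<open>inv f\<close> recovers their labels.\<close>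
      have u: "f (inv f (u i)) = u i \<and> PB x (inv f (u i))" if "i \<in> Ag n" for i
        using \<open>\<forall>i\<in>Ag n. _\<close> that x inj by (fastforce dest!: countermodel_relE simp: inj_eq)
      then obtain y where y: "\<forall>j\<in>Ag n. RStit j (inv f (u j)) y \<in> A"
        using ioa[of x "\<lambda>j. inv f (u j)"] by blast
      have "f y \<in> Rstit countermodel i `` {u i}" if "i \<in> Ag n" for i
      proof -
        have "PS i (inv f (u i)) y"
          using y that unfolding PS_def by (simp add: r_into_equivclp)
        then show ?thesis
          using u[OF that] countermodel_simps(3)[of "inv f (u i)" y i] by simp
      qed
      then show ?thesis by blast
    qed
  qed
  moreover have "frame_prop d countermodel i" if "d \<in> X" "i \<in> Ag n" for d i
  proof (cases d)
    case D2
    then show ?thesis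
      using d2[of i] that by simp (metis countermodel_simps(4))
  next
    case D3
    have "PB x y" if "ROught i x y \<in> A" for x y
      using d3[of i x y] that \<open>d \<in> X\<close> \<open>i \<in> Ag n\<close> D3 unfolding PB_def
      by (auto intro: r_into_equivclp)
    then show ?thesis
      using D3 by (auto dest!: countermodel_relE)
  next
    case D4
    then show ?thesis
      using d4[of i] that inj by (fastforce dest!: countermodel_relE simp: inj_eq)
  next
    case D5
    have "\<exists>v. (f x, v) \<in> Rought countermodel i \<and>
        Rstit countermodel i `` {v} \<subseteq> Rought countermodel i `` {f x}" for x
    proof -
      obtain y where "ROught i x y \<in> A" "\<forall>z. PS i y z \<longrightarrow> ROught i x z \<in> A"
        using d5 \<open>d \<in> X\<close> \<open>i \<in> Ag n\<close> D5 by blast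
      then show ?thesis
        using inj by (intro exI[of _ "f y"]) (auto dest!: countermodel_relE simp: inj_eq)
    qed
    then show ?thesis
      using D5 by simp
  qed
  ultimately show ?thesis
    by (auto simp: DSX_model_def DSX_frame_def countermodel_def)
qed

text \<open>The truth lemma: \<open>decompose\<close> supplies the refuting parts or successors,
  while \<open>dia\<close>, \<open>costit\<close> and \<open>coought\<close> pass a formula on to
  all successors. The bound on agents makes these conditions available.\<close>

lemma not_sat_countermodel:
  "(x, \<phi>) \<in> H \<Longrightarrow> form_agents \<phi> \<subseteq> Ag n \<Longrightarrow> \<not> sat countermodel (f x) \<phi>"
proof (induction \<phi> arbitrary: x)
  case (Pos p)
  then show ?case using consistent by auto
next
  case (Neg p)
  then show ?case by simp
next
  case (Or \<phi> \<psi>)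
  then show ?case using decompose[of x "Or \<phi> \<psi>"] by auto
next
  case (And \<phi> \<psi>)
  then show ?case using decompose[of x "And \<phi> \<psi>"] by auto
next
  case (Box \<phi>)
  then obtain y where "RBox x y \<in> A" "(y, \<phi>) \<in> H"
    using decompose[of x "Box \<phi>"] by auto
  moreover from this have "PB x y"
    unfolding PB_def by (auto intro: r_into_equivclp)
  ultimately show ?case
    using Box countermodel_simps(2) by force
next
  case (Dia \<phi>)
  then show ?case
    using dia inj by (fastforce dest!: countermodel_relE simp: inj_eq)
next
  case (Stit i \<phi>)
  then obtain y where "RStit i x y \<in> A" "(y, \<phi>) \<in> H"
    using decompose[of x "Stit i \<phi>"] by auto
  moreover from this have "PS i x y"
    unfolding PS_def by (auto intro: r_into_equivclp)
  ultimately show ?case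
    using Stit countermodel_simps(3) by force
next
  case (CoStit i \<phi>)
  then show ?case
    using costit[of i] inj by (fastforce dest!: countermodel_relE simp: inj_eq)
next
  case (Ought i \<phi>)
  then obtain y where "ROught i x y \<in> A" "(y, \<phi>) \<in> H"
    using decompose[of x "Ought i \<phi>"] by auto
  then show ?case
    using Ought countermodel_simps(4) by force
next
  case (CoOught i \<phi>)
  then show ?case
    using coought[of i] inj by (fastforce dest!: countermodel_relE simp: inj_eq)
qed

lemma ratom_holds_countermodel:
  assumes "a \<in> A"
  shows "ratom_holds countermodel f a"
  using assms by (cases a) (auto simp: PB_def PS_def intro: r_into_equivclp)

end

section \<open>The limit of a generic chain\<close>

text \<open>The premises of each closure condition involve finitely many facts, which all hold at
  one late enough stage. There the matching task is applicable, and its completion at some stage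
  gives the conclusion.\<close>

lemma saturated_limit:
  fixes \<sigma> :: "nat \<Rightarrow> ('p :: countable) stage" and f :: "label \<Rightarrow> 'w"
  assumes good: "\<And>k. good_stage n X (\<sigma> k)"
    and mono: "\<And>j k. j \<le> k \<Longrightarrow> extends (\<sigma> j) (\<sigma> k)"
    and complete: "\<And>t k. applicable n X (\<sigma> k) t \<Longrightarrow> \<exists>m. completed n (\<sigma> m) t"
    and "inj f"
  shows "saturated n X (\<Union>k. set_mset (Atoms (\<sigma> k))) (\<Union>k. Seen (\<sigma> k)) f"
proof -
  let ?A = "\<Union>k. set_mset (Atoms (\<sigma> k))" and ?H = "\<Union>k. Seen (\<sigma> k)"
  let ?PB = "equivclp (\<lambda>x y. RBox x y \<in> ?A \<or> (\<exists>j. RStit j x y \<in> ?A))"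
    and ?PS = "\<lambda>i. equivclp (\<lambda>x y. RStit i x y \<in> ?A)"
  have atom: "a \<in># Atoms (\<sigma> k)" if "a \<in># Atoms (\<sigma> j)" "j \<le> k" for a j k
    using mono[OF that(2)] that(1) by (auto simp: extends_def)
  have seen: "h \<in> Seen (\<sigma> k)" if "h \<in> Seen (\<sigma> j)" "j \<le> k" for h j k
    using mono[OF that(2)] that(1) by (auto simp: extends_def)
  have used: "h \<in> Used (\<sigma> k)" if "h \<in> Used (\<sigma> j)" "j \<le> k" for h j k
    using mono[OF that(2)] that(1) by (auto simp: extends_def)
  have dia_mono: "path_dia (Atoms (\<sigma> k)) x y" if "path_dia (Atoms (\<sigma> j)) x y" "j \<le> k" for x y j k
    using path_dia_mono[OF that(1)] mono[OF that(2)] by (auto simp: extends_def)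
  have stit_mono: "path_stit i (Atoms (\<sigma> k)) x y"
    if "path_stit i (Atoms (\<sigma> j)) x y" "j \<le> k" for i x y j k
    using path_stit_mono[OF that(1)] mono[OF that(2)] by (auto simp: extends_def)
  have PB: "\<exists>k. path_dia (Atoms (\<sigma> k)) x y" if "?PB x y" for x y
  proof -
    let ?r = "\<lambda>k x y. RBox x y \<in># Atoms (\<sigma> k) \<or> (\<exists>j. RStit j x y \<in># Atoms (\<sigma> k))"
    have "equivclp (\<lambda>x y. \<exists>k. ?r k x y) x y"
      using that by (rule equivclp_mono) auto
    then show ?thesis
      unfolding path_dia_def by (rule equivclp_chain_union) (use atom in blast)
  qed
  have PS: "\<exists>k. path_stit i (Atoms (\<sigma> k)) x y" if "?PS i x y" for i x y
  proof -
    have "equivclp (\<lambda>x y. \<exists>k. RStit i x y \<in># Atoms (\<sigma> k)) x y"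
      using that by (rule equivclp_mono) auto
    then show ?thesis
      unfolding path_stit_def by (rule equivclp_chain_union) (use atom in blast)
  qed
  show ?thesis
  proof
    show "inj f" by fact
  next
    fix x p assume "(x, Pos p) \<in> ?H"
    then obtain j where j: "(x, Pos p) \<in> Seen (\<sigma> j)" by auto
    have "(x, Neg p) \<notin> Seen (\<sigma> k)" for k
      using good_stage_consistent[OF good[of "max j k"]] seen[OF j, of "max j k"]
        seen[of "(x, Neg p)" k "max j k"] by auto
    then show "(x, Neg p) \<notin> ?H" by auto
  next
    fix x \<phi> assume "(x, \<phi>) \<in> ?H" "decomposable n \<phi>"
    then obtain m where "decomposed (set_mset (Atoms (\<sigma> m))) (Seen (\<sigma> m)) x \<phi>"
      using complete[of _ "TDecompose x \<phi>"] by auto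
    then show "decomposed ?A ?H x \<phi>"
      by (rule decomposed_mono) auto
  next
    fix x \<phi> y assume "(x, Dia \<phi>) \<in> ?H" "?PB x y"
    then obtain j k where "(x, Dia \<phi>) \<in> Seen (\<sigma> j)" "path_dia (Atoms (\<sigma> k)) x y"
      using PB by blast
    then have "applicable n X (\<sigma> (max j k)) (TDia x \<phi> y)"
      by (auto intro: seen dia_mono)
    then show "(y, \<phi>) \<in> ?H"
      using complete by fastforce
  next
    fix i x \<phi> y assume "i \<in> Ag n" "(x, CoStit i \<phi>) \<in> ?H" "?PS i x y"
    then obtain j k where "(x, CoStit i \<phi>) \<in> Seen (\<sigma> j)" "path_stit i (Atoms (\<sigma> k)) x y"
      using PS by blast
    then have "applicable n X (\<sigma> (max j k)) (TCoStit i x \<phi> y)"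
      using \<open>i \<in> Ag n\<close> by (auto intro: seen stit_mono)
    then show "(y, \<phi>) \<in> ?H"
      using complete by fastforce
  next
    fix i x \<phi> y assume "i \<in> Ag n" "(x, CoOught i \<phi>) \<in> ?H" "ROught i x y \<in> ?A"
    then obtain j k where "(x, CoOught i \<phi>) \<in> Seen (\<sigma> j)" "ROught i x y \<in># Atoms (\<sigma> k)"
      by blast
    then have "applicable n X (\<sigma> (max j k)) (TCoOught i x \<phi> y)"
      using \<open>i \<in> Ag n\<close> by (auto intro: seen atom)
    then show "(y, \<phi>) \<in> ?H"
      using complete by fastforce
  next
    fix w u assume "\<And>j. j \<in> Ag n \<Longrightarrow> ?PB w (u j)"
    then have "\<forall>j. \<exists>k. j \<in> Ag n \<longrightarrow> path_dia (Atoms (\<sigma> k)) w (u j)"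
      using PB by blast
    \<comment> \<open>There are finitely many agents, so the stages \<open>g j\<close> have a
      maximum, at which all the paths exist.\<close>
    then obtain g where g: "\<And>j. j \<in> Ag n \<Longrightarrow> path_dia (Atoms (\<sigma> (g j))) w (u j)"
      by metis
    define m where "m = Max (g ` Ag n)"
    have "path_dia (Atoms (\<sigma> m)) w (u j)" if "j \<in> Ag n" for j
      using dia_mono[OF g[OF that]] that by (auto simp: m_def Ag_def)
    \<comment> \<open>The rule asks for paths between consecutive labels; they run through
      \<open>w\<close>.\<close>
    then have "path_dia (Atoms (\<sigma> m)) (u j) (u k)" if "j \<in> Ag n" "k \<in> Ag n" for j k
      using that unfolding path_dia_def by (meson equivclp_sym equivclp_trans)
    \<comment> \<open>Agents are counted from 1 and list positions from 0, hence the length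
      \<open>Suc n\<close>.\<close>
    moreover define xs where "xs = map u [0..<Suc n]"
    have nth: "xs ! j = u j" if "j \<in> Ag n" for j
    proof -
      have "j < Suc n" using that by (simp add: Ag_def)
      then show ?thesis by (simp add: xs_def del: upt_Suc)
    qed
    ultimately have "applicable n X (\<sigma> m) (TIOA xs)"
      by simp
    then obtain l y where "\<forall>j\<in>Ag n. RStit j (xs ! j) y \<in># Atoms (\<sigma> l)"
      using complete[of m "TIOA xs"] by auto
    then show "\<exists>y. \<forall>j\<in>Ag n. RStit j (u j) y \<in> ?A"
      using nth by (intro exI[of _ y]) auto
  next
    fix i x z y assume "i \<in> Ag n" "ROught i x z \<in> ?A" "?PB x y"
    then obtain j k where "ROught i x z \<in># Atoms (\<sigma> j)" "path_dia (Atoms (\<sigma> k)) x y"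
      using PB by blast
    then have "applicable n X (\<sigma> (max j k)) (TD1 i x y z)"
      using \<open>i \<in> Ag n\<close> by (auto intro: atom dia_mono)
    then show "ROught i y z \<in> ?A"
      using complete by fastforce
  next
    fix i x assume "D2 \<in> X" "i \<in> Ag n"
    then show "\<exists>y. ROught i x y \<in> ?A"
      using complete[of 0 "TD2 i x"] by auto
  next
    fix i x y assume "D3 \<in> X" "i \<in> Ag n" "ROught i x y \<in> ?A"
    then show "RBox x y \<in> ?A"
      using complete[of _ "TD3 i x y"] by auto
  next
    fix i x y z assume "D4 \<in> X" "i \<in> Ag n" "ROught i x y \<in> ?A" "?PS i y z"
    then obtain j k where "ROught i x y \<in># Atoms (\<sigma> j)" "path_stit i (Atoms (\<sigma> k)) y z"
      using PS by blast
    then have "applicable n X (\<sigma> (max j k)) (TD4 i x y z)"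
      using \<open>D4 \<in> X\<close> \<open>i \<in> Ag n\<close> by (auto intro: atom stit_mono)
    then show "ROught i x z \<in> ?A"
      using complete by fastforce
  next
    fix i x assume X: "D5 \<in> X" "i \<in> Ag n"
    \<comment> \<open>The witness \<open>y\<close> is fixed before \<open>z\<close>: it comes from
      \<open>Used\<close>, so the second \<open>D5\<close> rule may refer to it for every later
      \<open>z\<close>.\<close>
    then obtain j y where y: "(i, x, y) \<in> Used (\<sigma> j)" "ROught i x y \<in># Atoms (\<sigma> j)"
      using complete[of 0 "TD5_1 i x"] by auto
    have "ROught i x z \<in> ?A" if z: "?PS i y z" for z
    proof -
      obtain k where "path_stit i (Atoms (\<sigma> k)) y z"
        using PS[OF z] by blast
      then have "applicable n X (\<sigma> (max j k)) (TD5_2 i x y z)"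
        using X y by (auto intro: used stit_mono)
      then show ?thesis
        using complete by fastforce
    qed
    then show "\<exists>y. ROught i x y \<in> ?A \<and> (\<forall>z. ?PS i y z \<longrightarrow> ROught i x z \<in> ?A)"
      using y(2) by blast
  qed
qed

section \<open>Completeness\<close>

theorem theoremA3:
  fixes n :: nat and X :: "dprop set" and \<Lambda> :: "('p :: countable) sequent"
  assumes "n \<ge> 1"
    and "sequent_over n \<Lambda>"
    and "infinite (UNIV :: 'w set)"
    and "valid TYPE('w) n X \<Lambda>"
  shows "derivable n X \<Lambda>"
proof (rule ccontr)
  assume "\<not> derivable n X \<Lambda>"
  \<comment> \<open>The search starts with no atom introduced by \<open>D5_1\<close>, matching the
    empty set in \<open>derivable\<close>.\<close>
  define s where "s = \<lparr>Used = {}, Atoms = fst \<Lambda>, Forms = snd \<Lambda>, Seen = set_mset (snd \<Lambda>)\<rparr>"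
  have "good_stage n X s"
    using \<open>\<not> derivable n X \<Lambda>\<close> by (auto simp: good_stage_def s_def derivable_def)
  then obtain \<sigma> :: "nat \<Rightarrow> 'p stage"
    where chain: "\<sigma> 0 = s \<and> (\<forall>k. good_stage n X (\<sigma> k)) \<and>
      (\<forall>j k. j \<le> k \<longrightarrow> extends (\<sigma> j) (\<sigma> k)) \<and>
      (\<forall>t k. applicable n X (\<sigma> k) t \<longrightarrow> (\<exists>m. completed n (\<sigma> m) t))"
    using generic_chain by meson
  then have start: "\<sigma> 0 = s"
    by blast
  \<comment> \<open>An infinite type of worlds contains a copy of the labels.\<close>
  obtain f :: "label \<Rightarrow> 'w" where f: "inj f"
    using assms(3) infinite_countable_subset by blast
  let ?A = "\<Union>k. set_mset (Atoms (\<sigma> k))" and ?H = "\<Union>k. Seen (\<sigma> k)"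
  interpret saturated n X ?A ?H
    "equivclp (\<lambda>x y. RBox x y \<in> ?A \<or> (\<exists>j. RStit j x y \<in> ?A))"
    "\<lambda>i. equivclp (\<lambda>x y. RStit i x y \<in> ?A)" f
    by (rule saturated_limit) (use chain f in auto)
  have "sat_sequent countermodel f \<Lambda>"
    using assms(4) DSX_model_countermodel by (simp add: valid_def)
  moreover have "a \<in> ?A" if "a \<in># fst \<Lambda>" for a
    using that start by (auto simp: s_def intro!: exI[of _ 0])
  \<comment> \<open>All atoms of the sequent hold in the countermodel, so validity makes one of its
    formulas true; but that formula lies in the limit and is refuted there.\<close>
  ultimately obtain z \<phi> where z: "(z, \<phi>) \<in># snd \<Lambda>" "sat countermodel (f z) \<phi>"
    using ratom_holds_countermodel unfolding sat_sequent_def by blast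
  have "(z, \<phi>) \<in> ?H"
    using z(1) start by (auto simp: s_def intro!: exI[of _ 0])
  moreover have "form_agents \<phi> \<subseteq> Ag n"
    using assms(2) z(1) by (auto simp: sequent_over_def)
  ultimately show False
    using not_sat_countermodel z(2) by blast
qed

end
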